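(* Let $d,n\ge 1$, let $H$ be a self-transpose $d\times d$ Hadamard matrix, and consider $n$ qudits, i.e. the Hilbert space $(\mathbb{C}^d)^{\otimes n}$. Prepare each qudit in the state $\sum_{i=0}^{d-1}|i\rangle$, and then, for $m=1,2,\dots,n-1$ in this order, apply the 2-qudit gate $Z_{m,m+1}$ to qudits $m$ and $m+1$, followed by the 1-qudit gate $H$ on qudit $m+1$. Then the resulting state is, up to a nonzero scalar factor, the $n$-partite qudit GHZ state $$|\mathrm{GHZ}_n\rangle=\sum_{k=0}^{d-1}|k,k,\dots,k\rangle .$$
   Context: A Hadamard matrix here is a unitary matrix all of whose entries have the same absolute value (so $|H_{a,b}|=1/\sqrt d$); self-transpose means $H_{a,b}=H_{b,a}$. The 1-qudit gate is the linear map on $\mathbb{C}^d$ with matrix $H$. The 2-qudit gate $Z_{i,j}$ acts on qudits $i,j$ as the diagonal unitary $|a\rangle_i|b\rangle_j\mapsto \sqrt d\,\overline{H}_{a,b}\,|a\rangle_i|b\rangle_j$ and as the identity on the other qudits. *)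

theory Defs
  imports Complex_Main "HOL-Library.FuncSet" "Jordan_Normal_Form.Schur_Decomposition"
begin

definition unitary_mat :: "nat \<Rightarrow> complex mat \<Rightarrow> bool" where
  "unitary_mat d U \<longleftrightarrow> U \<in> carrier_mat d d \<and>
     U * mat_adjoint U = 1\<^sub>m d \<and> mat_adjoint U * U = 1\<^sub>m d"

definition hadamard_mat :: "nat \<Rightarrow> complex mat \<Rightarrow> bool" where
  "hadamard_mat d H \<longleftrightarrow> unitary_mat d H \<and>
     (\<exists>r::real. \<forall>a<d. \<forall>b<d. cmod (H $$ (a, b)) = r)"

text \<open>
  The space \<open>(\<complex>\<^sup>d)\<^sup>\<otimes>\<^sup>n\<close> is represented in coordinates: the product basis vectors
  \<open>|x\<^sub>1, \<dots>, x\<^sub>n\<rangle>\<close> are labelled by the functions \<open>x\<close> from \<open>{1..n}\<close> to \<open>{0..<d}\<close>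
  (extensional, i.e. \<open>undefined\<close> outside \<open>{1..n}\<close>), and a vector is the function giving its
  coefficients, which is \<open>0\<close> at everything that is not such a label. In the same way, a vector
  of a single \<open>\<complex>\<^sup>d\<close> is a function on \<open>nat\<close> that vanishes outside \<open>{0..<d}\<close>.
\<close>

type_synonym label = "nat \<Rightarrow> nat"
type_synonym state = "label \<Rightarrow> complex"

definition labels :: "nat \<Rightarrow> nat \<Rightarrow> label set" where
  "labels d n = {1..n} \<rightarrow>\<^sub>E {0..<d}"

definition ket :: "label \<Rightarrow> state" where
  "ket x = (\<lambda>y. if y = x then 1 else 0)"

definition ket1 :: "nat \<Rightarrow> nat \<Rightarrow> complex" where
  "ket1 k = (\<lambda>a. if a = k then 1 else 0)"

definition tensor_state :: "nat \<Rightarrow> nat \<Rightarrow> (nat \<Rightarrow> nat \<Rightarrow> complex) \<Rightarrow> state" where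
  "tensor_state d n v = (\<lambda>x. if x \<in> labels d n then (\<Prod>j\<in>{1..n}. v j (x j)) else 0)"

definition linear_extension :: "nat \<Rightarrow> nat \<Rightarrow> (label \<Rightarrow> state) \<Rightarrow> state \<Rightarrow> state" where
  "linear_extension d n G \<psi> = (\<lambda>y. \<Sum>x\<in>labels d n. \<psi> x * G x y)"

text \<open>The linear map on \<open>\<complex>\<^sup>d\<close> with matrix \<open>U\<close> sends \<open>|b\<rangle>\<close> to \<open>\<Sum>\<^sub>a U\<^sub>a\<^sub>b |a\<rangle>\<close>.\<close>

definition one_qudit_gate :: "nat \<Rightarrow> nat \<Rightarrow> complex mat \<Rightarrow> nat \<Rightarrow> state \<Rightarrow> state" where
  "one_qudit_gate d n U j =
     linear_extension d n (\<lambda>x y. \<Sum>a<d. U $$ (a, x j) * ket (x(j := a)) y)"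

definition Z_gate :: "nat \<Rightarrow> nat \<Rightarrow> complex mat \<Rightarrow> nat \<Rightarrow> nat \<Rightarrow> state \<Rightarrow> state" where
  "Z_gate d n H i j =
     linear_extension d n (\<lambda>x y. complex_of_real (sqrt (real d)) * cnj (H $$ (x i, x j)) * ket x y)"

definition initial_state :: "nat \<Rightarrow> nat \<Rightarrow> state" where
  "initial_state d n = tensor_state d n (\<lambda>j a. \<Sum>i<d. ket1 i a)"

definition prepared_state :: "nat \<Rightarrow> nat \<Rightarrow> complex mat \<Rightarrow> state" where
  "prepared_state d n H =
     fold (\<lambda>m \<psi>. one_qudit_gate d n H (m + 1) (Z_gate d n H m (m + 1) \<psi>)) [1..<n]
       (initial_state d n)"

definition GHZ :: "nat \<Rightarrow> nat \<Rightarrow> state" where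
  "GHZ d n = (\<lambda>x. \<Sum>k<d. ket (\<lambda>j\<in>{1..n}. k) x)"

lemma linear_extension_ket:
  assumes "x \<in> labels d n"
  shows "linear_extension d n G (ket x) = G x"
proof -
  have fin: "finite (labels d n)"
    unfolding labels_def by (intro finite_PiE) auto
  have "(\<Sum>z\<in>labels d n. ket x z * G z y) = G x y" for y
  proof -
    have "(\<Sum>z\<in>labels d n. ket x z * G z y) = (\<Sum>z\<in>labels d n. if z = x then G z y else 0)"
      by (intro sum.cong) (auto simp: ket_def)
    also have "\<dots> = G x y" using fin assms by simp
    finally show ?thesis .
  qed
  then show ?thesis by (simp add: linear_extension_def)
qed

end

theory Submission
  imports Defs
begin

text \<open>
  After \<open>k\<close> rounds the first \<open>k + 1\<close> qudits are in a multiple of the GHZ state and the others are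
  still in the state \<open>\<Sum>\<^sub>i |i\<rangle>\<close>. One more round multiplies the coefficient of a label \<open>x\<close> by
  \<open>sqrt d * (\<Sum>b<d. H $$ (x (k + 2), b) * cnj (H $$ (x (k + 1), b)))\<close>; by unitarity this is
  \<open>sqrt d\<close> if \<open>x (k + 2) = x (k + 1)\<close> and \<open>0\<close> otherwise. So each round copies the common value
  to one more qudit, and the final factor is \<open>sqrt d ^ (n - 1)\<close>.
\<close>

lemma finite_labels: "finite (labels d n)"
  unfolding labels_def by (intro finite_PiE) auto

lemma labels_bound: "x \<in> labels d n \<Longrightarrow> j \<in> {1..n} \<Longrightarrow> x j < d"
  unfolding labels_def by (auto dest: PiE_mem)

lemma labels_upd: "x \<in> labels d n \<Longrightarrow> j \<in> {1..n} \<Longrightarrow> b < d \<Longrightarrow> x(j := b) \<in> labels d n"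
  unfolding labels_def by (auto simp: PiE_iff extensional_def)

text \<open>The gate is diagonal, so only the term \<open>x = y\<close> of the sum over labels
  survives, and there is no such term when \<open>y\<close> is not a label.\<close>

lemma Z_gate_apply:
  "Z_gate d n H i j \<psi> y =
     (if y \<in> labels d n then complex_of_real (sqrt d) * cnj (H $$ (y i, y j)) * \<psi> y else 0)"
proof -
  have "Z_gate d n H i j \<psi> y = (\<Sum>x\<in>labels d n.
      if x = y then complex_of_real (sqrt d) * cnj (H $$ (y i, y j)) * \<psi> y else 0)"
    unfolding Z_gate_def linear_extension_def ket_def by (intro sum.cong) auto
  then show ?thesis
    using finite_labels by simp
qed

text \<open>The definition pushes kets forward along columns of \<open>U\<close>; this is the dual,
  coefficientwise form. Only labels that differ from \<open>y\<close> at most at \<open>j\<close>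
  contribute to the coefficient at \<open>y\<close>, and they are parametrized by their entry
  \<open>b\<close> at \<open>j\<close>.\<close>

lemma one_qudit_gate_apply:
  assumes j: "j \<in> {1..n}"
  shows "one_qudit_gate d n U j \<psi> y =
     (if y \<in> labels d n then \<Sum>b<d. U $$ (y j, b) * \<psi> (y(j := b)) else 0)"
proof (cases "y \<in> labels d n")
  case False
  \<comment> \<open>Overwriting an entry by a value below \<open>d\<close> yields a label again, so
    no weight reaches a non-label.\<close>
  have "ket (x(j := a)) y = 0" if "x \<in> labels d n" "a < d" for x a
    using labels_upd[OF that(1) j that(2)] False by (auto simp: ket_def)
  then show ?thesis
    using False by (simp add: one_qudit_gate_def linear_extension_def)
next
  case True
  let ?S = "{x \<in> labels d n. x(j := y j) = y}"
  have yj: "y j < d"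
    using labels_bound[OF True j] .
  have inner: "(\<Sum>a<d. U $$ (a, x j) * ket (x(j := a)) y) =
      (if x(j := y j) = y then U $$ (y j, x j) else 0)" for x
  proof -
    \<comment> \<open>The ket is nonzero at \<open>y\<close> only for \<open>a = y j\<close>, and
      then only if \<open>x\<close> and \<open>y\<close> agree away from \<open>j\<close>.\<close>
    have "(\<Sum>a<d. U $$ (a, x j) * ket (x(j := a)) y) =
        (\<Sum>a<d. if a = y j then (if x(j := y j) = y then U $$ (y j, x j) else 0) else 0)"
      by (intro sum.cong) (auto simp: ket_def fun_eq_iff)
    then show ?thesis
      using yj by simp
  qed
  have "one_qudit_gate d n U j \<psi> y =
      (\<Sum>x\<in>labels d n. if x(j := y j) = y then U $$ (y j, x j) * \<psi> x else 0)"
    unfolding one_qudit_gate_def linear_extension_def inner by (intro sum.cong) auto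
  also have "\<dots> = (\<Sum>x\<in>?S. U $$ (y j, x j) * \<psi> x)"
    by (intro sum.inter_filter[symmetric] finite_labels)
  also have "\<dots> = (\<Sum>b<d. U $$ (y j, b) * \<psi> (y(j := b)))"
  proof (rule sum.reindex_bij_witness[of _ "\<lambda>b. y(j := b)" "\<lambda>x. x j"])
    fix x assume x: "x \<in> ?S"
    then show "x j \<in> {..<d}"
      using labels_bound j by blast
    have eq: "y(j := x j) = x"
      using x by (metis (mono_tags, lifting) fun_upd_triv fun_upd_upd mem_Collect_eq)
    then show "y(j := x j) = x" .
    show "U $$ (y j, x j) * \<psi> (y(j := x j)) = U $$ (y j, x j) * \<psi> x"
      by (simp add: eq)
  qed (use labels_upd[OF True j] in auto)
  finally show ?thesis
    using True by simp
qed

text \<open>Rows are orthonormal because the sum is the entry at \<open>(a, c)\<close> of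
  \<open>U * mat_adjoint U\<close>.\<close>

lemma unitary_mat_row_inner:
  assumes U: "unitary_mat d U" and a: "a < d" and c: "c < d"
  shows "(\<Sum>b<d. U $$ (a, b) * cnj (U $$ (c, b))) = (if a = c then 1 else 0)"
proof -
  have carr: "U \<in> carrier_mat d d" and UU: "U * mat_adjoint U = 1\<^sub>m d"
    using U by (auto simp: unitary_mat_def)
  have "(U * mat_adjoint U) $$ (a, c) = (\<Sum>b<d. U $$ (a, b) * cnj (U $$ (c, b)))"
    using carr a c
    by (auto simp: scalar_prod_def mat_adjoint_def mat_of_rows_def lessThan_atLeast0 intro!: sum.cong)
  then show ?thesis
    using UU a c by simp
qed

lemma initial_state_apply: "initial_state d n x = (if x \<in> labels d n then 1 else 0)"
proof -
  have "(\<Sum>i<d. ket1 i (x j)) = 1" if "x \<in> labels d n" "j \<in> {1..n}" for j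
    using labels_bound[OF that] by (simp add: ket1_def)
  then show ?thesis
    by (auto simp: initial_state_def tensor_state_def)
qed

(* A constant, because the unfolded equations x i = x 1 loop as rewrite rules. *)
definition agree_upto :: "nat \<Rightarrow> label \<Rightarrow> bool" where
  "agree_upto m x \<longleftrightarrow> (\<forall>i\<in>{1..m}. x i = x 1)"

lemma agree_uptoD: "agree_upto m x \<Longrightarrow> i \<in> {1..m} \<Longrightarrow> x i = x 1"
  unfolding agree_upto_def by blast

lemma agree_upto_1: "agree_upto (Suc 0) x"
  unfolding agree_upto_def by simp

text \<open>Agreement is measured against qudit 1, whereas \<open>Z_gate\<close> in a round couples
  neighbours; this translates between the two. For \<open>m = 0\<close> the right side would involve
  \<open>x 0\<close>, which belongs to no qudit.\<close>

lemma agree_upto_Suc: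
  assumes "m \<ge> 1"
  shows "agree_upto (Suc m) x \<longleftrightarrow> agree_upto m x \<and> x (Suc m) = x m"
proof -
  have "agree_upto (Suc m) x \<longleftrightarrow> agree_upto m x \<and> x (Suc m) = x 1"
    unfolding agree_upto_def atLeastAtMostSuc_conv[OF le_SucI[OF assms]] ball_simps by blast
  moreover have "x m = x 1" if "agree_upto m x"
    by (rule agree_uptoD[OF that]) (use assms in simp)
  ultimately show ?thesis
    by metis
qed

text \<open>This lets the condition on the earlier qudits be pulled out of the sum over the new
  value of qudit \<open>j\<close>.\<close>

lemma agree_upto_upd:
  assumes "1 < j" and "m < j"
  shows "agree_upto m (x(j := b)) \<longleftrightarrow> agree_upto m x"
  unfolding agree_upto_def using assms by (intro ball_cong) auto

text \<open>Extensionality fixes a label outside \<open>{1..n}\<close>, so agreement leaves only the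
  common value \<open>x 1\<close>, which is below \<open>d\<close> as qudit 1 exists.\<close>

lemma labels_agree_upto_iff:
  assumes "n \<ge> 1"
  shows "x \<in> labels d n \<and> agree_upto n x \<longleftrightarrow> (\<exists>k<d. x = (\<lambda>j\<in>{1..n}. k))"
proof
  assume x: "x \<in> labels d n \<and> agree_upto n x"
  have "x i = (\<lambda>j\<in>{1..n}. x 1) i" for i
  proof (cases "i \<in> {1..n}")
    case True
    then show ?thesis
      unfolding restrict_apply by (simp only: if_True) (metis x agree_uptoD)
  next
    case False
    then show ?thesis
      using x unfolding labels_def by (auto simp: PiE_iff extensional_def)
  qed
  moreover have "x 1 < d"
    using x assms labels_bound[of x d n 1] by simp
  ultimately show "\<exists>k<d. x = (\<lambda>j\<in>{1..n}. k)"
    by blast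
next
  assume "\<exists>k<d. x = (\<lambda>j\<in>{1..n}. k)"
  then obtain k where "k < d" and x: "x = (\<lambda>j\<in>{1..n}. k)"
    by blast
  then show "x \<in> labels d n \<and> agree_upto n x"
    unfolding x labels_def agree_upto_def using assms by simp
qed

lemma GHZ_apply:
  assumes n: "n \<ge> 1"
  shows "GHZ d n x = (if x \<in> labels d n \<and> agree_upto n x then 1 else 0)"
proof (cases "\<exists>k<d. x = (\<lambda>j\<in>{1..n}. k)")
  case True
  then obtain k where k: "k < d" and x: "x = (\<lambda>j\<in>{1..n}. k)"
    by blast
  \<comment> \<open>Since \<open>{1..n}\<close> is nonempty, different values give different
    constant labels, so exactly one ket contributes.\<close>
  have "x = (\<lambda>j\<in>{1..n}. l) \<longleftrightarrow> l = k" for l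
    using n unfolding x by (metis atLeastAtMost_iff le_refl restrict_apply)
  then have "GHZ d n x = 1"
    using k by (simp add: GHZ_def ket_def)
  then show ?thesis
    using True labels_agree_upto_iff[OF n] by (simp only: if_True)
next
  case False
  then have "GHZ d n x = 0"
    by (auto simp: GHZ_def ket_def intro!: sum.neutral)
  then show ?thesis
    using False labels_agree_upto_iff[OF n] by (simp only: if_False)
qed

text \<open>The list \<open>[1..<Suc k]\<close> holds \<open>k\<close> rounds, the last of which
  acts on qudit \<open>Suc k\<close>; \<open>k < n\<close> keeps that qudit in range.\<close>

lemma prepared_state_rounds:
  assumes U: "unitary_mat d H" and "k < n"
  shows "fold (\<lambda>m \<psi>. one_qudit_gate d n H (m + 1) (Z_gate d n H m (m + 1) \<psi>)) [1..<Suc k]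
      (initial_state d n) =
    (\<lambda>x. if x \<in> labels d n \<and> agree_upto (Suc k) x then complex_of_real (sqrt d) ^ k else 0)"
  using \<open>k < n\<close>
proof (induction k)
  case 0
  then show ?case
    by (simp add: initial_state_apply fun_eq_iff agree_upto_1)
next
  case (Suc k)
  let ?s = "complex_of_real (sqrt d)"
  let ?\<Psi> = "\<lambda>k x. if x \<in> labels d n \<and> agree_upto (Suc k) x then ?s ^ k else 0"
  let ?m = "Suc k"
  define j where "j = Suc ?m"
  have j: "j \<in> {1..n}" and m: "?m \<in> {1..n}" and "?m \<noteq> j" and "1 < j" and "?m < j"
    using Suc.prems by (auto simp: j_def)
  have step: "one_qudit_gate d n H j (Z_gate d n H ?m j (?\<Psi> k)) x = ?\<Psi> ?m x" for x
  proof (cases "x \<in> labels d n")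
    case False
    then show ?thesis
      by (simp add: one_qudit_gate_apply[OF j])
  next
    case True
    have "one_qudit_gate d n H j (Z_gate d n H ?m j (?\<Psi> k)) x =
        (\<Sum>b<d. H $$ (x j, b) * Z_gate d n H ?m j (?\<Psi> k) (x(j := b)))"
      using True by (simp add: one_qudit_gate_apply[OF j])
    \<comment> \<open>The coefficient of \<open>?\<Psi> k\<close> at \<open>x(j := b)\<close> is
      that at \<open>x\<close>, independent of \<open>b\<close>, because qudit \<open>j\<close> is
      still untouched; only the phase of \<open>Z_gate\<close> depends on \<open>b\<close>.\<close>
    also have "\<dots> = (\<Sum>b<d. ?s * ?\<Psi> k x * (H $$ (x j, b) * cnj (H $$ (x ?m, b))))"
      using True labels_upd[OF True j] \<open>?m \<noteq> j\<close> agree_upto_upd[OF \<open>1 < j\<close> \<open>?m < j\<close>]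
      by (intro sum.cong) (simp_all add: Z_gate_apply)
    also have "\<dots> = ?s * ?\<Psi> k x * (if x j = x ?m then 1 else 0)"
      unfolding sum_distrib_left[symmetric]
      by (simp only: unitary_mat_row_inner[OF U labels_bound[OF True j] labels_bound[OF True m]])
    also have "\<dots> = ?\<Psi> ?m x"
      using True agree_upto_Suc[of ?m x] by (simp add: j_def)
    finally show ?thesis .
  qed
  have IH: "fold (\<lambda>m \<psi>. one_qudit_gate d n H (m + 1) (Z_gate d n H m (m + 1) \<psi>)) [1..<?m]
      (initial_state d n) = ?\<Psi> k"
    using Suc.IH Suc.prems by (simp only: Suc_lessD)
  have "[1..<Suc ?m] = [1..<?m] @ [?m]"
    by simp
  then show ?case
    using step by (simp only: fold_append fold.simps comp_def id_apply IH) (simp add: j_def)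
qed

theorem mainTheorem4:
  fixes d n :: nat and H :: "complex mat"
  assumes "d \<ge> 1" and "n \<ge> 1"
    and "hadamard_mat d H"
    and "transpose_mat H = H"
  shows "\<exists>c::complex. c \<noteq> 0 \<and> prepared_state d n H = (\<lambda>x. c * GHZ d n x)"
proof (intro exI conjI)
  let ?c = "complex_of_real (sqrt d) ^ (n - 1)"
  show "?c \<noteq> 0"
    using \<open>d \<ge> 1\<close> by simp
  have "unitary_mat d H"
    using \<open>hadamard_mat d H\<close> by (simp add: hadamard_mat_def)
  \<comment> \<open>All of \<open>[1..<n]\<close> is the case \<open>k = n - 1\<close>, where
    \<open>Suc k = n\<close> because \<open>n \<ge> 1\<close>.\<close>
  from prepared_state_rounds[OF this, of "n - 1" n]
  have "prepared_state d n H =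
      (\<lambda>x. if x \<in> labels d n \<and> agree_upto n x then ?c else 0)"
    using \<open>n \<ge> 1\<close> by (simp add: prepared_state_def)
  then show "prepared_state d n H = (\<lambda>x. ?c * GHZ d n x)"
    by (simp only: GHZ_apply[OF \<open>n \<ge> 1\<close>] if_distrib[of "(*) _"] mult_1_right mult_zero_right)
qed

end
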